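(* For every $n\ge1$, the noncrossing arc diagrams on $n$ points that are matchings are in bijection with the permutations of $\{1,\ldots,n\}$ avoiding the consecutive pattern $321$, i.e. permutations $x$ having no $i$ with $x_i>x_{i+1}>x_{i+2}$.
   Context: Place points $1,\ldots,n$ bottom to top on a vertical line. An arc joins a point $p$ to a strictly higher point $q$, moving monotonically upward and passing left or right of each intermediate point; arcs are considered up to combinatorial equivalence (endpoints and the set of intermediate points on the left). A noncrossing arc diagram is a collection of arcs such that no two intersect except possibly at endpoints and no two share the same upper endpoint or the same lower endpoint, considered up to combinatorial equivalence. A noncrossing arc diagram is a matching if its arcs are pairwise disjoint, including at their endpoints. *)

theory Defs
  imports "HOL-Analysis.Analysis" "HOL-Combinatorics.Permutations"
begin

text \<open>
  Everything is drawn in the plane \<open>real \<times> real\<close>, whose first coordinate runs from left to right and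
  whose second coordinate is the height; the point labelled \<open>k\<close> sits on the line \<open>x = 0\<close>.
\<close>

definition pt :: "nat \<Rightarrow> real \<times> real" where
  "pt k = (0, real k)"

text \<open>
  Points outside \<open>{p..q}\<close> are avoided automatically, since the height increases strictly along \<open>c\<close>.
\<close>

definition is_arc :: "nat \<Rightarrow> (real \<Rightarrow> real \<times> real) \<Rightarrow> bool" where
  "is_arc n c \<longleftrightarrow> path c \<and> strict_mono_on {0..1} (\<lambda>t. snd (c t)) \<and>
     (\<exists>p q. 1 \<le> p \<and> p < q \<and> q \<le> n \<and> pathstart c = pt p \<and> pathfinish c = pt q \<and>
            (\<forall>k. p < k \<and> k < q \<longrightarrow> pt k \<notin> path_image c))"

text \<open>
  The numbered points at whose height \<open>c\<close> is strictly to the left of the vertical line. (Saying that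
  the arc passes left of the points, or that the points lie on the left of the arc, is the same up
  to complementing this set among the intermediate points, so it gives the same equivalence.)
\<close>

definition passed_on_left :: "nat \<Rightarrow> (real \<Rightarrow> real \<times> real) \<Rightarrow> nat set" where
  "passed_on_left n c = {k \<in> {1..n}. \<exists>x<0. (x, real k) \<in> path_image c}"

definition arc_equiv :: "nat \<Rightarrow> (real \<Rightarrow> real \<times> real) \<Rightarrow> (real \<Rightarrow> real \<times> real) \<Rightarrow> bool" where
  "arc_equiv n c d \<longleftrightarrow> pathstart c = pathstart d \<and> pathfinish c = pathfinish d \<and>
     passed_on_left n c = passed_on_left n d"

text \<open>
  The condition on endpoints also prevents one curve from occurring under two parametrisations.
\<close>

definition noncrossing_arc_diagram :: "nat \<Rightarrow> (real \<Rightarrow> real \<times> real) set \<Rightarrow> bool" where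
  "noncrossing_arc_diagram n D \<longleftrightarrow> (\<forall>c\<in>D. is_arc n c) \<and>
     pairwise (\<lambda>c d. path_image c \<inter> path_image d
                       \<subseteq> {pathstart c, pathfinish c} \<inter> {pathstart d, pathfinish d}
                   \<and> pathstart c \<noteq> pathstart d \<and> pathfinish c \<noteq> pathfinish d) D"

definition is_matching :: "(real \<Rightarrow> real \<times> real) set \<Rightarrow> bool" where
  "is_matching D \<longleftrightarrow> pairwise (\<lambda>c d. path_image c \<inter> path_image d = {}) D"

definition diagram_equiv ::
    "nat \<Rightarrow> ((real \<Rightarrow> real \<times> real) set \<times> (real \<Rightarrow> real \<times> real) set) set" where
  "diagram_equiv n = {(D, E). noncrossing_arc_diagram n D \<and> noncrossing_arc_diagram n E \<and>
     (\<exists>\<phi>. bij_betw \<phi> D E \<and> (\<forall>c\<in>D. arc_equiv n c (\<phi> c)))}"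

lemma equiv_diagram_equiv: "equiv {D. noncrossing_arc_diagram n D} (diagram_equiv n)"
proof (rule equivI)
  show "diagram_equiv n \<subseteq> {D. noncrossing_arc_diagram n D} \<times> {D. noncrossing_arc_diagram n D}"
    by (auto simp: diagram_equiv_def)
  show "refl_on {D. noncrossing_arc_diagram n D} (diagram_equiv n)"
    by (auto simp: refl_on_def diagram_equiv_def arc_equiv_def intro!: exI[of _ id])
  show "sym (diagram_equiv n)"
  proof (rule symI)
    fix D E assume "(D, E) \<in> diagram_equiv n"
    then obtain f where f: "noncrossing_arc_diagram n D" "noncrossing_arc_diagram n E"
      "bij_betw f D E" "\<forall>c\<in>D. arc_equiv n c (f c)"
      by (auto simp: diagram_equiv_def)
    have "arc_equiv n e (inv_into D f e)" if "e \<in> E" for e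
      using f(3,4) that bij_betw_inv_into_right[OF f(3) that] inv_into_into[of e f D]
      by (metis arc_equiv_def bij_betw_imp_surj_on)
    then show "(E, D) \<in> diagram_equiv n"
      using f bij_betw_inv_into[OF f(3)] by (auto simp: diagram_equiv_def)
  qed
  show "trans (diagram_equiv n)"
  proof (rule transI)
    fix C D E assume "(C, D) \<in> diagram_equiv n" "(D, E) \<in> diagram_equiv n"
    then obtain f g where fg: "noncrossing_arc_diagram n C" "noncrossing_arc_diagram n E"
      "bij_betw f C D" "\<forall>c\<in>C. arc_equiv n c (f c)" "bij_betw g D E" "\<forall>c\<in>D. arc_equiv n c (g c)"
      by (auto simp: diagram_equiv_def)
    have "arc_equiv n c ((g \<circ> f) c)" if "c \<in> C" for c
      using fg(4,6) that bij_betwE[OF fg(3)] by (auto simp: arc_equiv_def)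
    then show "(C, E) \<in> diagram_equiv n"
      using fg(1,2) bij_betw_trans[OF fg(3,5)] by (auto simp: diagram_equiv_def)
  qed
qed

lemma is_matching_respects_diagram_equiv:
  assumes "(D, E) \<in> diagram_equiv n" "is_matching D"
  shows "is_matching E"
  unfolding is_matching_def
proof (rule pairwiseI)
  obtain f where f: "noncrossing_arc_diagram n E" "bij_betw f D E" "\<forall>c\<in>D. arc_equiv n c (f c)"
    using assms(1) by (auto simp: diagram_equiv_def)
  fix c' d' assume "c' \<in> E" "d' \<in> E" "c' \<noteq> d'"
  then obtain c d where cd: "c \<in> D" "d \<in> D" "c \<noteq> d" "c' = f c" "d' = f d"
    using f(2) by (metis bij_betw_imp_surj_on imageE)
  have "path_image c \<inter> path_image d = {}"
    using assms(2) cd by (auto simp: is_matching_def pairwise_def)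
  moreover have "path_image c' \<inter> path_image d'
      \<subseteq> {pathstart c', pathfinish c'} \<inter> {pathstart d', pathfinish d'}"
    using f(1) \<open>c' \<in> E\<close> \<open>d' \<in> E\<close> \<open>c' \<noteq> d'\<close>
    by (simp add: noncrossing_arc_diagram_def pairwise_def)
  moreover have "pathstart c' = pathstart c" "pathfinish c' = pathfinish c"
      "pathstart d' = pathstart d" "pathfinish d' = pathfinish d"
    using f(3) cd by (auto simp: arc_equiv_def)
  ultimately show "path_image c' \<inter> path_image d' = {}"
    by (smt (verit, best) disjoint_iff in_mono Int_iff insert_iff empty_iff
        pathstart_in_path_image pathfinish_in_path_image)
qed

definition avoids_consecutive_321 :: "nat \<Rightarrow> (nat \<Rightarrow> nat) \<Rightarrow> bool" where
  "avoids_consecutive_321 n x \<longleftrightarrow>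
     \<not> (\<exists>i. 1 \<le> i \<and> i + 2 \<le> n \<and> x i > x (i + 1) \<and> x (i + 1) > x (i + 2))"

end

theory Submission imports Defs begin

text \<open>
  A permutation \<open>x\<close> is sent to the diagram with one arc from \<open>x (i + 1)\<close> to \<open>x i\<close> for each descent \<open>i\<close>,
  passing to the left of exactly those intermediate points that occur later in the word \<open>x\<close>. To draw
  it, plot the points \<open>(i, x i)\<close>, join descents by segments, and shear horizontally so that all
  points land on the line; two segments can only meet where two descents are consecutive, which the
  pattern condition excludes. The data of the arcs generate the inversions of \<open>x\<close> transitively and
  so determine \<open>x\<close>. Conversely, the arcs and isolated points of a matching are disjoint graphs over
  the vertical axis, hence can be ranked from left to right. The rank shows that there are orders
  of the points in which each arc has its upper endpoint before its lower one and every
  intermediate point on the correct side; among them, one that cannot be improved by sorting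
  adjacent points has its descents exactly at the arcs.
\<close>

text \<open>In a triple \<open>(p, q, L)\<close> the points of \<open>L\<close> lie to the right of the arc.\<close>

definition arc_data :: "nat \<Rightarrow> (real \<Rightarrow> real \<times> real) set \<Rightarrow> (nat \<times> nat \<times> nat set) set" where
  "arc_data n D = {(p, q, L). \<exists>c\<in>D. pathstart c = pt p \<and> pathfinish c = pt q \<and> passed_on_left n c = L}"

definition descent_data :: "nat \<Rightarrow> (nat \<Rightarrow> nat) \<Rightarrow> (nat \<times> nat \<times> nat set) set" where
  "descent_data n x =
     {(x (i + 1), x i, {k. x (i + 1) < k \<and> k < x i \<and> i + 1 < inv x k}) |i.
        1 \<le> i \<and> i < n \<and> x (i + 1) < x i}"

section \<open>Recovering a permutation from its descents\<close>

text \<open>The inversions forced by a single arc: \<open>a\<close> is its upper endpoint or lies to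
  its left, hence comes early in the word, and \<open>b\<close> is its lower endpoint or lies to its
  right, hence comes late.\<close>

definition side_rel :: "(nat \<times> nat \<times> nat set) set \<Rightarrow> (nat \<times> nat) set" where
  "side_rel S = {(a, b). b < a \<and>
     (\<exists>p q L. (p, q, L) \<in> S \<and> p \<le> b \<and> a \<le> q \<and> (a = q \<or> a \<notin> L) \<and> (b = p \<or> b \<in> L))}"

lemma ex_last_before_switch:
  fixes i j :: nat
  assumes "i < j" "P i" "\<not> P j"
  shows "\<exists>k. i \<le> k \<and> k < j \<and> P k \<and> \<not> P (k + 1)"
  using assms
proof (induction j)
  case (Suc j)
  show ?case
  proof (cases "P j")
    case True
    then show ?thesis using Suc.prems by (intro exI[of _ j]) auto
  next
    case False
    then have "i < j" using Suc.prems by (metis less_antisym)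
    then show ?thesis using Suc False less_SucI by blast
  qed
qed simp

text \<open>
  If no value strictly between \<open>x j\<close> and \<open>x i\<close> occurs between the positions \<open>i\<close> and \<open>j\<close>, a single
  descent jumps over both values there.
\<close>

lemma inversion_imp_side_rel:
  assumes x: "x permutes {1..n}"
  shows "1 \<le> i \<Longrightarrow> i < j \<Longrightarrow> j \<le> n \<Longrightarrow> x j < x i \<Longrightarrow> (x i, x j) \<in> (side_rel (descent_data n x))\<^sup>+"
proof (induction "j - i" arbitrary: i j rule: less_induct)
  case less
  show ?case
  proof (cases "\<exists>m. i < m \<and> m < j \<and> x j < x m \<and> x m < x i")
    case True
    then obtain m where m: "i < m" "m < j" "x j < x m" "x m < x i" by blast
    \<comment> \<open>An intermediate value splits the inversion into two whose positions are closer
      together.\<close>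
    have "(x i, x m) \<in> (side_rel (descent_data n x))\<^sup>+"
      by (rule less.hyps) (use m less.prems in auto)
    moreover have "(x m, x j) \<in> (side_rel (descent_data n x))\<^sup>+"
      by (rule less.hyps) (use m less.prems in auto)
    ultimately show ?thesis by (rule trancl_trans)
  next
    case False
    \<comment> \<open>On the way from \<open>i\<close> to \<open>j\<close> the word drops somewhere
      below \<open>x i\<close>; as no value strictly between \<open>x j\<close> and
      \<open>x i\<close> is available there, the drop lands at or below \<open>x j\<close>.\<close>
    obtain k where k: "i \<le> k" "k < j" "x i \<le> x k" "\<not> x i \<le> x (k + 1)"
      using ex_last_before_switch[of i j "\<lambda>k. x i \<le> x k"] less.prems by auto
    have k1: "x (k + 1) \<le> x j"
    proof (rule ccontr)
      assume gt: "\<not> x (k + 1) \<le> x j"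
      then have "k + 1 \<noteq> j" by auto
      then have "i < k + 1 \<and> k + 1 < j \<and> x j < x (k + 1) \<and> x (k + 1) < x i" using k gt by linarith
      then show False using False by blast
    qed
    let ?L = "{m. x (k + 1) < m \<and> m < x k \<and> k + 1 < inv x m}"
    have "(x (k + 1), x k, ?L) \<in> descent_data n x"
      using k less.prems unfolding descent_data_def by auto
    moreover have "x i = x k \<or> x i \<notin> ?L"
      using k permutes_inverses(2)[OF x] by auto
    moreover have "x j = x (k + 1) \<or> x j \<in> ?L"
    proof (cases "k + 1 = j")
      case f: False
      then have "x j \<noteq> x (k + 1)" using permutes_inj[OF x] by (auto dest: injD)
      then show ?thesis
        using k k1 less.prems f permutes_inverses(2)[OF x] by auto
    qed auto
    ultimately have "(x i, x j) \<in> side_rel (descent_data n x)"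
      unfolding side_rel_def using k k1 less.prems by blast
    then show ?thesis by blast
  qed
qed

text \<open>The descent at \<open>i\<close> cuts the word: the early element of a related pair sits
  at a position at most \<open>i\<close>, the late one at a position at least \<open>i + 1\<close>.
  Chains of such pairs compose.\<close>

lemma side_rel_imp_inversion:
  assumes x: "x permutes {1..n}" and ab: "(a, b) \<in> (side_rel (descent_data n x))\<^sup>+"
  shows "inv x a < inv x b"
proof -
  have single: "inv x a < inv x b" if ab: "(a, b) \<in> side_rel (descent_data n x)" for a b
  proof -
    obtain i where i: "b < a" "x (i + 1) \<le> b" "a \<le> x i"
      "a = x i \<or> \<not> (x (i + 1) < a \<and> a < x i \<and> i + 1 < inv x a)"
      "b = x (i + 1) \<or> i + 1 < inv x b"
      using ab unfolding side_rel_def descent_data_def by (auto simp: le_less)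
    have inv: "inv x (x k) = k" for k using permutes_inverses(2)[OF x] by auto
    \<comment> \<open>Not lying to the right of the arc still allows position \<open>i + 1\<close>,
      but the value there is at most \<open>b\<close>.\<close>
    have "a \<noteq> x (i + 1)" using i by auto
    then have "inv x a \<noteq> i + 1" using permutes_inverses(1)[OF x, of a] by metis
    then have "inv x a \<le> i" using i inv by (metis le_eq_less_or_eq le_less_trans less_Suc_eq_le not_le Suc_eq_plus1)
    moreover have "i + 1 \<le> inv x b" using i inv by auto
    ultimately show ?thesis by auto
  qed
  show ?thesis
    using ab
  proof (induction rule: trancl_induct)
    case (base y)
    then show ?case by (rule single)
  next
    case (step y z)
    then show ?case using less_trans[OF step.IH single] by simp
  qed
qed

text \<open>Recovers a permutation from the comparisons of its values, so that two permutations with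
  the same comparisons agree.\<close>

lemma permutes_eq_card_le:
  assumes "r permutes {1..n}" "a \<in> {1..n}"
  shows "r a = card {b \<in> {1..n}. r b \<le> r a}"
proof -
  have "r ` {b \<in> {1..n}. r b \<le> r a} = {1..r a}"
  proof (intro equalityI subsetI)
    fix c assume c: "c \<in> {1..r a}"
    then have "c \<in> {1..n}" using permutes_in_image[OF assms(1), of a] assms(2) by auto
    then obtain b where "b \<in> {1..n}" "c = r b"
      using permutes_image[OF assms(1)] by blast
    then show "c \<in> r ` {b \<in> {1..n}. r b \<le> r a}" using c by auto
  qed (use permutes_in_image[OF assms(1)] in auto)
  then show ?thesis
    using card_image[OF permutes_inj_on[OF assms(1)], of "{b \<in> {1..n}. r b \<le> r a}"] by simp
qed

text \<open>By \<open>inversion_imp_side_rel\<close> and \<open>side_rel_imp_inversion\<close> the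
  inversions form a transitive closure computed from the descent data alone; they fix all
  comparisons of positions, and these fix \<open>inv x\<close>.\<close>

lemma inj_on_descent_data: "inj_on (descent_data n) {x. x permutes {1..n}}"
proof (rule inj_onI)
  fix x y assume "x \<in> {x. x permutes {1..n}}" "y \<in> {x. x permutes {1..n}}"
    and eq: "descent_data n x = descent_data n y"
  then have x: "x permutes {1..n}" and y: "y permutes {1..n}" by auto
  have char: "inv z a < inv z b \<longleftrightarrow> (a, b) \<in> (side_rel (descent_data n z))\<^sup>+"
    if z: "z permutes {1..n}" and ab: "a \<in> {1..n}" "b \<in> {1..n}" "b < a" for z a b
  proof
    assume "inv z a < inv z b"
    then show "(a, b) \<in> (side_rel (descent_data n z))\<^sup>+"
      using inversion_imp_side_rel[OF z, of "inv z a" "inv z b"]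
        permutes_in_image[OF permutes_inv[OF z]] ab permutes_inverses(1)[OF z]
      by (metis atLeastAtMost_iff)
  qed (rule side_rel_imp_inversion[OF z])
  have lt: "inv x a < inv x b \<longleftrightarrow> inv y a < inv y b" if "a \<in> {1..n}" "b \<in> {1..n}" "b < a" for a b
    using char[OF x that] char[OF y that] eq by simp
  have neq: "inv z a \<noteq> inv z b" if "z permutes {1..n}" "a \<noteq> b" for z a b
    using permutes_inj[OF permutes_inv[OF that(1)]] that(2) by (auto dest: injD)
  have le: "inv x b \<le> inv x a \<longleftrightarrow> inv y b \<le> inv y a" if "a \<in> {1..n}" "b \<in> {1..n}" for a b
    using lt[of a b] lt[of b a] that neq[OF x, of a b] neq[OF y, of a b]
    by (cases a b rule: linorder_cases) auto
  have "inv x a = inv y a" for a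
  proof (cases "a \<in> {1..n}")
    case True
    have "{b \<in> {1..n}. inv x b \<le> inv x a} = {b \<in> {1..n}. inv y b \<le> inv y a}"
      using le[OF True] by blast
    then show ?thesis
      using permutes_eq_card_le[OF permutes_inv[OF x] True] permutes_eq_card_le[OF permutes_inv[OF y] True]
      by simp
  next
    case False
    then show ?thesis
      using permutes_not_in[OF permutes_inv[OF x]] permutes_not_in[OF permutes_inv[OF y]] by simp
  qed
  then show "x = y" using permutes_inv_inv[OF x] permutes_inv_inv[OF y] by (metis ext)
qed

section \<open>Words with prescribed descents\<close>

text \<open>\<open>r a\<close> is the position of the value \<open>a\<close> in a word, so
  \<open>r\<close> is the inverse of the permutation sought. As \<open>q\<close> comes before
  \<open>p\<close>, every intermediate point is kept out of the stretch between them: right-hand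
  points come after \<open>p\<close>, left-hand ones before \<open>q\<close>.\<close>

definition compatible :: "nat \<Rightarrow> (nat \<times> nat \<times> nat set) set \<Rightarrow> (nat \<Rightarrow> nat) \<Rightarrow> bool" where
  "compatible n S r \<longleftrightarrow> r permutes {1..n} \<and>
     (\<forall>(p, q, L)\<in>S. r q < r p \<and>
        (\<forall>k. p < k \<and> k < q \<longrightarrow> (k \<in> L \<longrightarrow> r p < r k) \<and> (k \<notin> L \<longrightarrow> r k < r q)))"

text \<open>A left-to-right ranking in which both endpoints of an arc share one value, so that an
  intermediate point is compared with the arc as a whole.\<close>

definition ranks :: "nat \<Rightarrow> (nat \<times> nat \<times> nat set) set \<Rightarrow> (nat \<Rightarrow> real) \<Rightarrow> bool" where
  "ranks n S F \<longleftrightarrow>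
     (\<forall>(p, q, L)\<in>S. 1 \<le> p \<and> p < q \<and> q \<le> n \<and> L \<subseteq> {p<..<q} \<and> F p = F q \<and>
        (\<forall>k. p < k \<and> k < q \<longrightarrow> (k \<in> L \<longrightarrow> F p < F k) \<and> (k \<notin> L \<longrightarrow> F k < F q)))"

text \<open>The ranking is refined to a total order \<open>before\<close>: ties are broken with the
  higher point first, which puts the upper endpoint of an arc before the lower one. \<open>r\<close>
  counts the initial segments of this order.\<close>

lemma ex_compatible:
  assumes "ranks n S F"
  shows "\<exists>r. compatible n S r"
proof -
  define before where "before a b \<longleftrightarrow> F a < F b \<or> (F a = F b \<and> b < a)" for a b
  define r where "r a = (if a \<in> {1..n} then card {b \<in> {1..n}. b = a \<or> before b a} else a)" for a
  have mono: "r a < r b" if "a \<in> {1..n}" "b \<in> {1..n}" "before a b" for a b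
  proof -
    have "{c \<in> {1..n}. c = a \<or> before c a} \<subset> {c \<in> {1..n}. c = b \<or> before c b}"
      using that unfolding before_def by force
    then have "card {c \<in> {1..n}. c = a \<or> before c a} < card {c \<in> {1..n}. c = b \<or> before c b}"
      by (intro psubset_card_mono) auto
    then show ?thesis using that by (auto simp: r_def)
  qed
  have "inj_on r {1..n}"
  proof (rule inj_onI)
    fix a b assume ab: "a \<in> {1..n}" "b \<in> {1..n}" "r a = r b"
    have "a = b \<or> before a b \<or> before b a" unfolding before_def by linarith
    then show "a = b" using mono[of a b] mono[of b a] ab by auto
  qed
  moreover have "r ` {1..n} \<subseteq> {1..n}"
  proof clarify
    fix a assume a: "a \<in> {1..n}"
    have "card {b \<in> {1..n}. b = a \<or> before b a} \<le> card {1..n}" by (intro card_mono) auto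
    moreover have "card {a} \<le> card {b \<in> {1..n}. b = a \<or> before b a}"
      using a by (intro card_mono) auto
    ultimately show "r a \<in> {1..n}" using a by (simp add: r_def)
  qed
  ultimately have "r permutes {1..n}"
    using endo_inj_surj[of "{1..n}" r] by (intro bij_imp_permutes) (auto simp: bij_betw_def, auto simp: r_def)
  moreover have "r q < r p \<and> (\<forall>k. p < k \<and> k < q \<longrightarrow> (k \<in> L \<longrightarrow> r p < r k) \<and> (k \<notin> L \<longrightarrow> r k < r q))"
    if "(p, q, L) \<in> S" for p q L
    using assms that unfolding ranks_def by (fastforce intro!: mono simp: before_def)
  ultimately show ?thesis unfolding compatible_def by blast
qed

text \<open>The swap reverses only the order of \<open>inv r i\<close> and
  \<open>inv r (i + 1)\<close>, of which the larger comes first. Conditions on intermediate points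
  always ask for a smaller value before a larger one, so only a condition \<open>r q < r p\<close>
  could break, and \<open>nS\<close> excludes an arc joining these two values.\<close>

lemma compatible_swap:
  assumes r: "compatible n S r" and i: "1 \<le> i" "i < n"
    and nS: "\<And>L. (inv r (i + 1), inv r i, L) \<notin> S" and desc: "inv r (i + 1) < inv r i"
    and S: "\<And>p q L. (p, q, L) \<in> S \<Longrightarrow> p < q"
  shows "compatible n S (Transposition.transpose i (i + 1) \<circ> r)"
proof -
  let ?t = "Transposition.transpose i (i + 1)"
  have p: "r permutes {1..n}" using r by (simp add: compatible_def)
  have "(?t \<circ> r) permutes {1..n}"
    using i by (intro permutes_compose[OF p] permutes_swap_id) auto
  moreover have ord: "?t (r u) < ?t (r v)" if "r u < r v" "u \<noteq> inv r i \<or> v \<noteq> inv r (i + 1)" for u v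
  proof -
    have "\<not> (r u = i \<and> r v = i + 1)" using that(2) permutes_inverses(2)[OF p] by metis
    then show ?thesis using that(1) by (auto simp: Transposition.transpose_def)
  qed
  moreover have "(?t \<circ> r) q < (?t \<circ> r) p \<and>
     (\<forall>k. p < k \<and> k < q \<longrightarrow> (k \<in> L \<longrightarrow> (?t \<circ> r) p < (?t \<circ> r) k) \<and> (k \<notin> L \<longrightarrow> (?t \<circ> r) k < (?t \<circ> r) q))"
    if m: "(p, q, L) \<in> S" for p q L
  proof -
    have c: "r q < r p" "\<And>k. p < k \<Longrightarrow> k < q \<Longrightarrow> k \<in> L \<Longrightarrow> r p < r k"
      "\<And>k. p < k \<Longrightarrow> k < q \<Longrightarrow> k \<notin> L \<Longrightarrow> r k < r q"
      using r m unfolding compatible_def by auto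
    have "\<not> (q = inv r i \<and> p = inv r (i + 1))" using nS m by auto
    moreover have "\<not> (p = inv r i \<and> k = inv r (i + 1))" "\<not> (k = inv r i \<and> q = inv r (i + 1))"
      if "p < k" "k < q" for k using desc that by auto
    ultimately show ?thesis using c ord unfolding comp_def by blast
  qed
  ultimately show ?thesis unfolding compatible_def by blast
qed

text \<open>Only two terms change: the larger value \<open>inv r i\<close> moves up one position and
  \<open>inv r (i + 1)\<close> moves down one, a net gain of their difference.\<close>

lemma swap_descent_weight:
  fixes r :: "nat \<Rightarrow> nat"
  assumes r: "r permutes {1..n}" and i: "1 \<le> i" "i < n" and desc: "inv r (i + 1) < inv r i"
  shows "(\<Sum>a\<in>{1..n}. a * r a) < (\<Sum>a\<in>{1..n}. a * Transposition.transpose i (i + 1) (r a))"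
proof -
  let ?a = "inv r i" and ?b = "inv r (i + 1)" and ?t = "Transposition.transpose i (i + 1)"
  have ab: "?a \<in> {1..n}" "?b \<in> {1..n}"
    unfolding permutes_in_image[OF permutes_inv[OF r]] using i by auto
  have split: "sum f {1..n} = f ?a + (f ?b + sum f ({1..n} - {?a} - {?b}))" for f :: "nat \<Rightarrow> nat"
    using ab desc by (subst sum.remove[OF _ ab(1)], simp, subst sum.remove[of _ ?b]) auto
  have rest: "(\<Sum>a\<in>{1..n} - {?a} - {?b}. a * ?t (r a)) = (\<Sum>a\<in>{1..n} - {?a} - {?b}. a * r a)"
  proof (rule sum.cong)
    fix a assume "a \<in> {1..n} - {?a} - {?b}"
    then have "r a \<noteq> i" "r a \<noteq> i + 1" using permutes_inverses(2)[OF r, of a] by auto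
    then show "a * ?t (r a) = a * r a" by (simp add: transpose_apply_other)
  qed simp
  show ?thesis
    unfolding split[of "\<lambda>a. a * r a"] split[of "\<lambda>a. a * ?t (r a)"] rest
    using desc by (simp add: permutes_inverses[OF r])
qed

text \<open>
  The permutation is the inverse of a compatible \<open>r\<close> maximising \<open>\<Sum>a. a * r a\<close>: swapping a descent
  increases this weight, and destroys compatibility only if the descent is an arc.
\<close>

lemma ex_permutation_descent_data:
  assumes F: "ranks n S F"
    and disj: "\<And>p q L p' q' L'. (p, q, L) \<in> S \<Longrightarrow> (p', q', L') \<in> S \<Longrightarrow>
      {p, q} \<inter> {p', q'} \<noteq> {} \<Longrightarrow> (p, q, L) = (p', q', L')"
  shows "\<exists>x. x permutes {1..n} \<and> avoids_consecutive_321 n x \<and> descent_data n x = S"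
proof -
  let ?w = "\<lambda>r. \<Sum>a\<in>{1..n}. a * r a :: nat"
  have fin: "finite {r. compatible n S r}"
    by (rule finite_subset[OF _ finite_permutations[of "{1..n}"]]) (auto simp: compatible_def)
  obtain r where r: "compatible n S r" and max: "\<And>s. compatible n S s \<Longrightarrow> ?w s \<le> ?w r"
  proof -
    have "Max (?w ` {r. compatible n S r}) \<in> ?w ` {r. compatible n S r}"
      using fin ex_compatible[OF F] by (intro Max_in) auto
    then obtain r where "compatible n S r" "?w r = Max (?w ` {r. compatible n S r})" by auto
    then show ?thesis using fin by (intro that[of r]) auto
  qed
  have p: "r permutes {1..n}" using r by (simp add: compatible_def)
  define x where "x = inv r"
  have x: "x permutes {1..n}" and ix: "inv x = r"
    using permutes_inv[OF p] permutes_inv_inv[OF p] by (auto simp: x_def)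
  have xr: "x (r a) = a" "r (x a) = a" for a
    using permutes_inverses[OF p] by (auto simp: x_def)
  have arcD: "1 \<le> p" "p < q" "q \<le> n" "L \<subseteq> {p<..<q}" "F p = F q"
      "\<And>k. p < k \<Longrightarrow> k < q \<Longrightarrow> k \<in> L \<Longrightarrow> F p < F k" "\<And>k. p < k \<Longrightarrow> k < q \<Longrightarrow> k \<notin> L \<Longrightarrow> F k < F q"
      "r q < r p" "\<And>k. p < k \<Longrightarrow> k < q \<Longrightarrow> k \<in> L \<Longrightarrow> r p < r k" "\<And>k. p < k \<Longrightarrow> k < q \<Longrightarrow> k \<notin> L \<Longrightarrow> r k < r q"
    if m: "(p, q, L) \<in> S" for p q L
    using bspec[OF F[unfolded ranks_def] m] bspec[OF conjunct2[OF r[unfolded compatible_def]] m]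
    by auto
  have desc_arc: "\<exists>L. (x (i + 1), x i, L) \<in> S" if i: "1 \<le> i" "i < n" "x (i + 1) < x i" for i
  proof (rule ccontr)
    assume "\<nexists>L. (x (i + 1), x i, L) \<in> S"
    then have "compatible n S (Transposition.transpose i (i + 1) \<circ> r)"
      using i arcD(2) unfolding x_def by (intro compatible_swap[OF r]) auto
    then show False
      using max swap_descent_weight[OF p i[unfolded x_def]] by (force simp: comp_def)
  qed
  \<comment> \<open>No value strictly between \<open>p\<close> and \<open>q\<close> occurs between
    their positions, so some descent \<open>k\<close> in that stretch drops from at least
    \<open>q\<close> to at most \<open>p\<close>, and it is itself an arc. The aim is to show that
    this arc is the given one.\<close>
  have adj: "r p = r q + 1" if m: "(p, q, L) \<in> S" for p q L
  proof -
    note a = arcD[OF m]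
    obtain k where k: "r q \<le> k" "k < r p" "q \<le> x k" "\<not> q \<le> x (k + 1)"
      using ex_last_before_switch[of "r q" "r p" "\<lambda>k. q \<le> x k"] a xr by auto
    have rn: "1 \<le> r q" "r p \<le> n"
      using permutes_in_image[OF p, of p] permutes_in_image[OF p, of q] a by auto
    have xk: "x (k + 1) \<le> p"
    proof (rule ccontr)
      assume "\<not> x (k + 1) \<le> p"
      then have "p < x (k + 1)" "x (k + 1) < q" using k by auto
      from a(9)[OF this] a(10)[OF this] show False using k xr by (cases "x (k + 1) \<in> L") auto
    qed
    obtain L' where m': "(x (k + 1), x k, L') \<in> S"
      using desc_arc[of k] k a rn by auto
    note a' = arcD[OF m']
    show ?thesis
    proof (cases "x k = q \<or> x (k + 1) = p")
      case True
      then have "x (k + 1) = p \<and> x k = q" using disj[OF m m'] by auto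
      then show ?thesis using xr by metis
    next
      \<comment> \<open>Otherwise that arc spans both points, with \<open>q\<close> to its left and
        \<open>p\<close> to its right. Its rank then lies strictly between \<open>F q\<close> and
        \<open>F p\<close>, which are equal.\<close>
      case False
      then have o: "x (k + 1) < p" "q < x k" using k xk by auto
      have "q \<notin> L'" using a'(9)[of q] o a k xr by auto
      then have "F q < F (x k)" using a'(7)[of q] o a by auto
      moreover have "p \<in> L'" using a'(10)[of p] o a k xr by auto
      then have "F (x k) < F p" using a'(5) a'(6)[of p] o a by auto
      ultimately show ?thesis using a by auto
    qed
  qed
  have L: "L = {k. p < k \<and> k < q \<and> r p < r k}" if m: "(p, q, L) \<in> S" for p q L
    proof (intro equalityI subsetI)
    fix k assume "k \<in> L"
    then show "k \<in> {k. p < k \<and> k < q \<and> r p < r k}" using arcD(4)[OF m] arcD(9)[OF m] by auto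
  next
    fix k assume "k \<in> {k. p < k \<and> k < q \<and> r p < r k}"
    then show "k \<in> L" using arcD(10)[OF m, of k] arcD(8)[OF m] by fastforce
  qed
  have "descent_data n x = S"
  proof (intro equalityI subsetI)
    fix s assume "s \<in> descent_data n x"
    then obtain i where i: "1 \<le> i" "i < n" "x (i + 1) < x i"
      "s = (x (i + 1), x i, {k. x (i + 1) < k \<and> k < x i \<and> i + 1 < r k})"
      unfolding descent_data_def ix by blast
    obtain L' where L': "(x (i + 1), x i, L') \<in> S" using desc_arc i by blast
    from L[OF this] L' show "s \<in> S" using i(4) xr by simp
  next
    fix s assume "s \<in> S"
    then obtain p q L' where s: "s = (p, q, L')" "(p, q, L') \<in> S" by (cases s) auto
    note a = arcD[OF s(2)]
    have rn: "1 \<le> r q" "r p \<le> n"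
      using permutes_in_image[OF p, of p] permutes_in_image[OF p, of q] a by auto
    have "x (r q + 1) = p" "x (r q) = q" using adj[OF s(2)] xr by metis+
    then show "s \<in> descent_data n x"
      unfolding descent_data_def ix s(1) L[OF s(2)]
      using rn adj[OF s(2)] a by (intro CollectI exI[of _ "r q"]) auto
  qed
  moreover have "avoids_consecutive_321 n x"
    unfolding avoids_consecutive_321_def
  proof clarify
    fix i assume i: "1 \<le> i" "i + 2 \<le> n" "x (i + 1) < x i" "x (i + 2) < x (i + 1)"
    \<comment> \<open>Two consecutive descents would be two arcs sharing the point
      \<open>x (i + 1)\<close>.\<close>
    obtain L' L'' where "(x (i + 1), x i, L') \<in> S" "(x (i + 2), x (i + 1), L'') \<in> S"
      using desc_arc[of i] desc_arc[of "i + 1"] i by auto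
    from disj[OF this] i show False by auto
  qed
  ultimately show ?thesis using x by blast
qed

section \<open>Ranking disjoint graphs from left to right\<close>

lemma finite_sets_separated:
  fixes A B :: "real set"
  assumes "finite A" "finite B" "\<And>a b. a \<in> A \<Longrightarrow> b \<in> B \<Longrightarrow> a < b"
  shows "\<exists>z. (\<forall>a\<in>A. a < z) \<and> (\<forall>b\<in>B. z < b)"
proof -
  consider "A = {}" "B = {}" | "A = {}" "B \<noteq> {}" | "A \<noteq> {}" "B = {}" | "A \<noteq> {}" "B \<noteq> {}"
    by blast
  then show ?thesis
  proof cases
    case 2
    have "\<forall>b\<in>B. Min B - 1 < b" using Min_le[OF assms(2)] by force
    then show ?thesis using 2 by blast
  next
    case 3
    have "\<forall>a\<in>A. a < Max A + 1" using Max_ge[OF assms(1)] by force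
    then show ?thesis using 3 by blast
  next
    case 4
    have "Max A < Min B" using assms 4 by simp
    then obtain z where "Max A < z" "z < Min B" using dense by blast
    then show ?thesis using 4 assms by (intro exI[of _ z]) (auto simp: Max_less_iff Min_gr_iff)
  qed auto
qed

text \<open>Elements are inserted by decreasing \<open>h\<close>, so the new element
  \<open>a\<close> has minimal \<open>h\<close> and the restricted transitivity applies with
  \<open>a\<close> in the middle: everything before \<open>a\<close> is already ranked below
  everything after it, which leaves a gap for its value.\<close>

lemma ex_strict_rank:
  fixes h :: "'b \<Rightarrow> real" and lt :: "'b \<Rightarrow> 'b \<Rightarrow> bool"
  assumes "finite V" and irrefl: "\<And>a. a \<in> V \<Longrightarrow> \<not> lt a a"
    and trans: "\<And>a b c. a \<in> V \<Longrightarrow> b \<in> V \<Longrightarrow> c \<in> V \<Longrightarrow> lt b a \<Longrightarrow> lt a c \<Longrightarrow>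
      h a \<le> h b \<Longrightarrow> h a \<le> h c \<Longrightarrow> lt b c"
  shows "\<exists>F :: 'b \<Rightarrow> real. \<forall>a\<in>V. \<forall>b\<in>V. lt a b \<longrightarrow> F a < F b"
  using assms
proof (induction V rule: finite_ranking_induct[where f = "\<lambda>a. - h a"])
  case (insert a S)
  have "\<exists>F :: 'b \<Rightarrow> real. \<forall>b\<in>S. \<forall>c\<in>S. lt b c \<longrightarrow> F b < F c"
  proof (rule insert.IH)
    show "\<not> lt b b" if "b \<in> S" for b using insert.prems(1) that by simp
    show "lt b d" if "c \<in> S" "b \<in> S" "d \<in> S" "lt b c" "lt c d" "h c \<le> h b" "h c \<le> h d" for c b d
      using insert.prems(2)[of c b d] that by simp
  qed
  then obtain F :: "'b \<Rightarrow> real" where F: "\<forall>b\<in>S. \<forall>c\<in>S. lt b c \<longrightarrow> F b < F c" by blast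
  show ?case
  proof (cases "a \<in> S")
    case True
    then show ?thesis using F by (auto simp: insert_absorb)
  next
    case False
    have "lt b c" if "b \<in> S" "c \<in> S" "lt b a" "lt a c" for b c
      using insert.prems(2)[of a b c] insert.hyps(2) that by force
    then obtain z where z: "\<forall>b\<in>F ` {b \<in> S. lt b a}. b < z" "\<forall>c\<in>F ` {c \<in> S. lt a c}. z < c"
      using finite_sets_separated[of "F ` {b \<in> S. lt b a}" "F ` {c \<in> S. lt a c}"] F insert.hyps(1)
      by force
    show ?thesis
    proof (intro exI ballI impI)
      fix b c assume "b \<in> insert a S" "c \<in> insert a S" "lt b c"
      then show "(F(a := z)) b < (F(a := z)) c"
        using z F False insert.prems(1)[of a] by auto
    qed
  qed
qed simp

text \<open>The graph of a continuous function of the height over a compact, possibly empty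
  interval; it covers arcs and single points alike.\<close>

definition height_graph :: "(real \<times> real) set \<Rightarrow> bool" where
  "height_graph K \<longleftrightarrow> compact K \<and> connected K \<and> inj_on snd K"

text \<open>One common height suffices, since for disjoint height graphs all common heights agree by
  \<open>left_of_at_common_height\<close>.\<close>

definition left_of :: "(real \<times> real) set \<Rightarrow> (real \<times> real) set \<Rightarrow> bool" where
  "left_of K K' \<longleftrightarrow> (\<exists>x x' y. (x, y) \<in> K \<and> (x', y) \<in> K' \<and> x < x')"

lemma height_graph_heights:
  assumes "height_graph K" "y \<in> snd ` K" "y' \<in> snd ` K" "y \<le> s" "s \<le> y'"
  shows "\<exists>x. (x, s) \<in> K"
proof -
  have "connected (snd ` K)"
    using assms(1) by (intro connected_continuous_image continuous_intros) (simp add: height_graph_def)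
  then have "s \<in> snd ` K" using connectedD_interval assms(2-5) by blast
  then show ?thesis by force
qed

text \<open>A continuous injection on a compact set has a continuous inverse, here applied to
  \<open>snd\<close>.\<close>

lemma height_graph_continuous:
  assumes "height_graph K"
  obtains f where "continuous_on (snd ` K) f" "\<And>x y. (x, y) \<in> K \<Longrightarrow> f y = x"
    "\<And>y. y \<in> snd ` K \<Longrightarrow> (f y, y) \<in> K"
proof -
  have K: "compact K" "inj_on snd K" using assms by (auto simp: height_graph_def)
  let ?f = "\<lambda>y. fst (inv_into K snd y)"
  have "continuous_on (snd ` K) (inv_into K snd)"
    using K by (intro continuous_on_inv continuous_intros) auto
  then have cont: "continuous_on (snd ` K) ?f" by (intro continuous_intros)
  have eq: "?f y = x" if "(x, y) \<in> K" for x y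
    using inv_into_f_f[OF K(2) that] by simp
  have "(?f y, y) \<in> K" if y: "y \<in> snd ` K" for y
    using y eq by force
  then show thesis using that[of ?f] cont eq by blast
qed

text \<open>The common heights form an interval on which the difference of the horizontal
  coordinates is continuous; a change of sign would give a zero, which is a common point of the two
  graphs.\<close>

lemma left_of_at_common_height:
  assumes K: "height_graph K" "height_graph K'" "K \<inter> K' = {}" and lt: "left_of K K'"
    and zs: "(z, s) \<in> K" "(z', s) \<in> K'"
  shows "z < z'"
proof (rule ccontr)
  assume nlt: "\<not> z < z'"
  obtain x x' y where xy: "(x, y) \<in> K" "(x', y) \<in> K'" "x < x'"
    using lt by (auto simp: left_of_def)
  obtain f where f: "continuous_on (snd ` K) f" "\<And>x y. (x, y) \<in> K \<Longrightarrow> f y = x"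
    "\<And>y. y \<in> snd ` K \<Longrightarrow> (f y, y) \<in> K" using height_graph_continuous[OF K(1)] by blast
  obtain g where g: "continuous_on (snd ` K') g" "\<And>x y. (x, y) \<in> K' \<Longrightarrow> g y = x"
    "\<And>y. y \<in> snd ` K' \<Longrightarrow> (g y, y) \<in> K'" using height_graph_continuous[OF K(2)] by blast
  let ?J = "snd ` K \<inter> snd ` K'"
  have "connected (snd ` K)" "connected (snd ` K')"
    using K by (auto intro!: connected_continuous_image continuous_intros simp: height_graph_def)
  then have "connected ?J"
    by (simp add: is_interval_connected_1[symmetric] is_interval_Int)
  moreover have "continuous_on ?J (\<lambda>y. f y - g y)"
    by (intro continuous_intros continuous_on_subset[OF f(1)] continuous_on_subset[OF g(1)]) auto
  ultimately have "connected ((\<lambda>y. f y - g y) ` ?J)" by (rule connected_continuous_image[rotated])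
  moreover have "f y - g y \<in> (\<lambda>y. f y - g y) ` ?J" "f s - g s \<in> (\<lambda>y. f y - g y) ` ?J"
    using xy zs by (auto intro!: imageI) force+
  moreover have "f y - g y \<le> 0" "0 \<le> f s - g s"
    using f(2) g(2) xy zs nlt by auto
  ultimately have "0 \<in> (\<lambda>y. f y - g y) ` ?J"
    using connectedD_interval by blast
  then obtain u where "u \<in> ?J" "f u - g u = 0" by (metis (no_types, lifting) imageE)
  then have "u \<in> ?J" "f u = g u" by auto
  then show False using f(3)[of u] g(3)[of u] K(3) by auto
qed

text \<open>
  Among pairwise disjoint graphs the one with the lowest top meets each horizontally comparable
  graph at the height of that top; this is why its neighbours are consistently ordered.
\<close>

lemma ex_rank_height_graphs:
  assumes fin: "finite V" and gr: "\<And>K. K \<in> V \<Longrightarrow> height_graph K" and disj: "disjoint V"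
  shows "\<exists>F :: (real \<times> real) set \<Rightarrow> real. \<forall>K\<in>V. \<forall>K'\<in>V. left_of K K' \<longrightarrow> F K < F K'"
proof (rule ex_strict_rank[where h = "\<lambda>K. Sup (snd ` K)", OF fin])
  have irrefl: "\<not> left_of K K" if "K \<in> V" for K
  proof
    assume "left_of K K"
    then obtain x x' y where "(x, y) \<in> K" "(x', y) \<in> K" "x < x'" by (auto simp: left_of_def)
    moreover have "inj_on snd K" using gr[OF that] by (simp add: height_graph_def)
    ultimately show False using inj_onD[of snd K "(x, y)" "(x', y)"] by simp
  qed
  then show "\<not> left_of K K" if "K \<in> V" for K using that .
  fix A B C
  assume V: "A \<in> V" "B \<in> V" "C \<in> V" and lt: "left_of B A" "left_of A C"
    and top: "Sup (snd ` A) \<le> Sup (snd ` B)" "Sup (snd ` A) \<le> Sup (snd ` C)"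
  let ?t = "Sup (snd ` A)"
  have comp: "compact (snd ` K)" if "K \<in> V" for K
    using gr[OF that] by (intro compact_continuous_image continuous_intros) (simp add: height_graph_def)
  have Sup: "Sup (snd ` K) \<in> snd ` K" "y \<le> Sup (snd ` K)" if "K \<in> V" "y \<in> snd ` K" for K and y :: real
    using comp[OF that(1)] that(2)
    by (auto intro!: closed_contains_Sup cSup_upper
        intro: bounded_imp_bdd_above compact_imp_bounded compact_imp_closed)
  have at_top: "\<exists>x. (x, ?t) \<in> K" if "K \<in> V" "?t \<le> Sup (snd ` K)" "y \<in> snd ` A" "y \<in> snd ` K" for K y
    using height_graph_heights[OF gr[OF that(1)], of y "Sup (snd ` K)" ?t] Sup that V(1) by blast
  obtain y where y: "y \<in> snd ` B" "y \<in> snd ` A" using lt(1) unfolding left_of_def by force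
  obtain y' where y': "y' \<in> snd ` A" "y' \<in> snd ` C" using lt(2) unfolding left_of_def by force
  obtain a b c where abc: "(a, ?t) \<in> A" "(b, ?t) \<in> B" "(c, ?t) \<in> C"
    using at_top[of A y] at_top[of B y] at_top[of C y'] V top y y' by auto
  have "B \<noteq> A" "A \<noteq> C" using lt irrefl V by auto
  then have "B \<inter> A = {}" "A \<inter> C = {}"
    using disj V unfolding pairwise_def disjnt_def by blast+
  then have "b < a" "a < c"
    using left_of_at_common_height[OF gr gr _ lt(1) abc(2,1)] left_of_at_common_height[OF gr gr _ lt(2) abc(1,3)] V
    by auto
  then show "left_of B C" using abc unfolding left_of_def by (intro exI[of _ b] exI[of _ c] exI[of _ ?t]) auto
qed

section \<open>The arcs of a matching\<close>

lemma pt_eq_iff [simp]: "pt i = pt j \<longleftrightarrow> i = j"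
  by (simp add: pt_def)

lemma is_arcI:
  assumes "path c" "strict_mono_on {0..1} (\<lambda>t. snd (c t))" "1 \<le> p" "p < q" "q \<le> n"
    "pathstart c = pt p" "pathfinish c = pt q" "\<And>k. p < k \<Longrightarrow> k < q \<Longrightarrow> pt k \<notin> path_image c"
  shows "is_arc n c"
  unfolding is_arc_def using assms by (intro conjI exI allI impI) auto

lemma is_arcE:
  assumes "is_arc n c"
  obtains p q where "1 \<le> p" "p < q" "q \<le> n" "pathstart c = pt p" "pathfinish c = pt q"
    "\<And>k. p < k \<Longrightarrow> k < q \<Longrightarrow> pt k \<notin> path_image c"
  using assms unfolding is_arc_def by blast

lemma height_graph_arc:
  assumes "is_arc n c"
  shows "height_graph (path_image c)"
proof -
  have c: "path c" "strict_mono_on {0..1} (\<lambda>t. snd (c t))" using assms by (auto simp: is_arc_def)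
  have "inj_on snd (path_image c)"
    unfolding path_image_def
    using strict_mono_on_imp_inj_on[OF c(2)] by (auto simp: inj_on_def)
  then show ?thesis using c by (simp add: height_graph_def compact_path_image connected_path_image)
qed

lemma passed_on_left_between:
  assumes "is_arc n c" "pathstart c = pt p" "pathfinish c = pt q"
  shows "passed_on_left n c \<subseteq> {p<..<q}"
proof
  fix k assume "k \<in> passed_on_left n c"
  then obtain x t where x: "x < 0" and t: "t \<in> {0..1}" "c t = (x, real k)"
    unfolding passed_on_left_def path_image_def by (auto simp: image_iff)
  have m: "strict_mono_on {0..1} (\<lambda>t. snd (c t))" using assms by (simp add: is_arc_def)
  have ends: "c 0 = (0, real p)" "c 1 = (0, real q)"
    using assms by (auto simp: pathstart_def pathfinish_def pt_def)
  have "t \<noteq> 0" "t \<noteq> 1" using t ends x by auto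
  then have "0 < t" "t < 1" using t by auto
  then have "snd (c 0) < snd (c t)" "snd (c t) < snd (c 1)"
    using strict_mono_onD[OF m, of 0 t] strict_mono_onD[OF m, of t 1] t by auto
  then show "k \<in> {p<..<q}" using ends t by auto
qed

lemma matching_arc_data_disjoint:
  assumes "is_matching D" "(p, q, L) \<in> arc_data n D" "(p', q', L') \<in> arc_data n D"
    "{p, q} \<inter> {p', q'} \<noteq> {}"
  shows "(p, q, L) = (p', q', L')"
proof -
  obtain c where c: "c \<in> D" "pathstart c = pt p" "pathfinish c = pt q" "passed_on_left n c = L"
    using assms(2) by (auto simp: arc_data_def)
  obtain d where d: "d \<in> D" "pathstart d = pt p'" "pathfinish d = pt q'" "passed_on_left n d = L'"
    using assms(3) by (auto simp: arc_data_def)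
  have "pt p \<in> path_image c" "pt q \<in> path_image c" "pt p' \<in> path_image d" "pt q' \<in> path_image d"
    using c d by (metis pathstart_in_path_image pathfinish_in_path_image)+
  then have "path_image c \<inter> path_image d \<noteq> {}" using assms(4) by auto
  then have "c = d" using assms(1) c(1) d(1) by (auto simp: is_matching_def pairwise_def)
  then show ?thesis using c d by simp
qed

text \<open>Each point takes the rank of the one graph on which it lies: an arc, or the point itself
  if it is isolated.\<close>

lemma ex_ranks_arc_data:
  assumes D: "noncrossing_arc_diagram n D" "is_matching D"
  shows "\<exists>F. ranks n (arc_data n D) F"
proof -
  have arc: "is_arc n c" if "c \<in> D" for c using D(1) that by (simp add: noncrossing_arc_diagram_def)
  \<comment> \<open>Finiteness of \<open>D\<close>: distinct arcs have distinct lower endpoints,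
    chosen among \<open>n\<close> points.\<close>
  have "inj_on pathstart D"
    using D(1) by (auto simp: noncrossing_arc_diagram_def pairwise_def inj_on_def)
  moreover have "pathstart ` D \<subseteq> pt ` {1..n}"
    using arc by (fastforce elim: is_arcE)
  ultimately have "finite D" by (meson finite_surj finite_imageD finite_atLeastAtMost)
  \<comment> \<open>The points on no arc are added as singletons, so that every point lies on
    exactly one member of \<open>V\<close>.\<close>
  define V where "V = path_image ` D \<union> (\<lambda>k. {pt k}) ` {k \<in> {1..n}. \<forall>c\<in>D. pt k \<notin> path_image c}"
  have fin: "finite V" using \<open>finite D\<close> by (simp add: V_def)
  have gr: "height_graph K" if "K \<in> V" for K
  proof -
    consider c where "c \<in> D" "K = path_image c" | k where "K = {pt k}"
      using \<open>K \<in> V\<close> unfolding V_def by blast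
    then show ?thesis
    proof cases
      case 1
      then show ?thesis using height_graph_arc[OF arc] by simp
    qed (simp add: height_graph_def)
  qed
  have disj: "disjoint V"
  proof (rule pairwiseI)
    fix A B assume AB: "A \<in> V" "B \<in> V" "A \<noteq> B"
    have "A \<inter> B = {}" if "c \<in> D" "d \<in> D" "A = path_image c" "B = path_image d" for c d
    proof -
      have "c \<noteq> d" using AB(3) that by auto
      then show ?thesis using D(2) that by (auto simp: is_matching_def pairwise_def)
    qed
    moreover have "(\<exists>c\<in>D. K = path_image c) \<or> (\<exists>k. K = {pt k} \<and> (\<forall>c\<in>D. pt k \<notin> path_image c))"
      if "K \<in> V" for K using that unfolding V_def by blast
    from this[OF AB(1)] this[OF AB(2)] have "A \<inter> B = {}"
    proof (elim disjE bexE exE conjE)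
    qed (use AB(3) calculation in auto)
    then show "disjnt A B" by (simp add: disjnt_def)
  qed
  obtain F :: "(real \<times> real) set \<Rightarrow> real" where F: "\<And>K K'. K \<in> V \<Longrightarrow> K' \<in> V \<Longrightarrow> left_of K K' \<Longrightarrow> F K < F K'"
    using ex_rank_height_graphs[OF fin gr disj] by blast
  have "\<forall>k\<in>{1..n}. \<exists>K\<in>V. pt k \<in> K"
  proof
    fix k assume "k \<in> {1..n}"
    then show "\<exists>K\<in>V. pt k \<in> K"
      by (cases "\<exists>c\<in>D. pt k \<in> path_image c") (auto simp: V_def)
  qed
  then obtain B where B: "\<And>k. k \<in> {1..n} \<Longrightarrow> B k \<in> V \<and> pt k \<in> B k" by metis
  have uniq: "B k = K" if "k \<in> {1..n}" "K \<in> V" "pt k \<in> K" for k K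
    using disj B[OF that(1)] that unfolding pairwise_def disjnt_def by blast
  have main: "1 \<le> p \<and> p < q \<and> q \<le> n \<and> L \<subseteq> {p<..<q} \<and> F (B p) = F (B q) \<and>
        (\<forall>k. p < k \<and> k < q \<longrightarrow> (k \<in> L \<longrightarrow> F (B p) < F (B k)) \<and> (k \<notin> L \<longrightarrow> F (B k) < F (B q)))"
    if "(p, q, L) \<in> arc_data n D" for p q L
  proof -
    obtain c where c: "c \<in> D" "pathstart c = pt p" "pathfinish c = pt q" "passed_on_left n c = L"
      using \<open>(p, q, L) \<in> arc_data n D\<close> by (auto simp: arc_data_def)
    have pq: "1 \<le> p" "p < q" "q \<le> n" "\<And>k. p < k \<Longrightarrow> k < q \<Longrightarrow> pt k \<notin> path_image c"
      using arc[OF c(1)] c(2,3) unfolding is_arc_def by auto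
    let ?K = "path_image c"
    have ends: "pt p \<in> ?K" "pt q \<in> ?K"
      using c by (metis pathstart_in_path_image pathfinish_in_path_image)+
    have K: "?K \<in> V" using c by (auto simp: V_def)
    have Bpq: "B p = ?K" "B q = ?K" using uniq K ends pq by auto
    have "(k \<in> L \<longrightarrow> F ?K < F (B k)) \<and> (k \<notin> L \<longrightarrow> F (B k) < F ?K)" if k: "p < k" "k < q" for k
    proof -
      have kn: "k \<in> {1..n}" using k pq by auto
      note Bk = B[OF kn]
      have "real p \<in> snd ` ?K" "real q \<in> snd ` ?K" using ends by (force simp: pt_def)+
      then obtain x where x: "(x, real k) \<in> ?K"
        using height_graph_heights[OF gr[OF K], of "real p" "real q" "real k"] k by auto
      have L: "k \<in> L \<longleftrightarrow> (\<exists>y<0. (y, real k) \<in> ?K)"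
        using kn by (simp add: c(4)[symmetric] passed_on_left_def)
      \<comment> \<open>The arc crosses height \<open>k\<close> off the axis: a negative abscissa
        puts it left of the graph through \<open>pt k\<close>, a positive one right of it.\<close>
      have "x \<noteq> 0" using x pq(4)[OF k] by (auto simp: pt_def)
      then have "x > 0" if "k \<notin> L" using that x L by force
      moreover have "F ?K < F (B k)" if "y < 0" "(y, real k) \<in> ?K" for y
        using that Bk by (intro F K) (auto simp: left_of_def pt_def)
      moreover have "F (B k) < F ?K" if "x > 0"
        using that x Bk by (intro F K) (auto simp: left_of_def pt_def)
      ultimately show ?thesis using L by blast
    qed
    then show ?thesis
      using pq Bpq passed_on_left_between[OF arc[OF c(1)] c(2,3)] c(4) by auto
  qed
  have "ranks n (arc_data n D) (\<lambda>k. F (B k))"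
    unfolding ranks_def
  proof
    fix z assume z: "z \<in> arc_data n D"
    obtain p q L where zp: "z = (p, q, L)" by (cases z)
    show "case z of (p, q, L) \<Rightarrow> 1 \<le> p \<and> p < q \<and> q \<le> n \<and> L \<subseteq> {p<..<q} \<and> F (B p) = F (B q) \<and>
        (\<forall>k. p < k \<and> k < q \<longrightarrow> (k \<in> L \<longrightarrow> F (B p) < F (B k)) \<and> (k \<notin> L \<longrightarrow> F (B k) < F (B q)))"
      unfolding zp prod.case by (rule main) (use z zp in simp)
  qed
  then show ?thesis by blast
qed

section \<open>Drawing a permutation\<close>

text \<open>A sum of tent functions, each vanishing at every integer other than its centre.\<close>

lemma ex_continuous_interpolation:
  fixes v :: "nat \<Rightarrow> real"
  shows "\<exists>s. continuous_on UNIV s \<and> (\<forall>k\<in>{1..n}. s (real k) = v k)"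
proof (intro exI conjI ballI)
  let ?s = "\<lambda>y. \<Sum>k\<in>{1..n}. v k * max 0 (1 - \<bar>y - real k\<bar>)"
  show "continuous_on UNIV ?s" by (intro continuous_intros)
  fix j assume j: "j \<in> {1..n}"
  have "?s (real j) = (\<Sum>k\<in>{1..n}. if k = j then v k else 0)"
  proof (rule sum.cong)
    fix k
    have "1 \<le> \<bar>real j - real k\<bar>" if "k \<noteq> j" using that by linarith
    then show "v k * max 0 (1 - \<bar>real j - real k\<bar>) = (if k = j then v k else 0)" by auto
  qed simp
  then show "?s (real j) = v j" using j by simp
qed

lemma disjoint_arcs_diagram:
  assumes "\<And>c. c \<in> D \<Longrightarrow> is_arc n c" "is_matching D"
  shows "noncrossing_arc_diagram n D"
  unfolding noncrossing_arc_diagram_def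
proof (intro conjI ballI pairwiseI)
  fix c d assume "c \<in> D" "d \<in> D" "c \<noteq> d"
  then have e: "path_image c \<inter> path_image d = {}" using assms(2) by (auto simp: is_matching_def pairwise_def)
  then show "path_image c \<inter> path_image d \<subseteq> {pathstart c, pathfinish c} \<inter> {pathstart d, pathfinish d}"
    by simp
  show "pathstart c \<noteq> pathstart d" "pathfinish c \<noteq> pathfinish d"
    using e by (metis pathstart_in_path_image pathfinish_in_path_image disjoint_iff)+
qed (use assms in auto)

lemma ex_diagram_descent_data:
  assumes x: "x permutes {1..n}" and av: "avoids_consecutive_321 n x"
  shows "\<exists>D. noncrossing_arc_diagram n D \<and> is_matching D \<and> arc_data n D = descent_data n x"
proof -
  \<comment> \<open>\<open>s\<close> is the amount of the shear: at the height of a value it equals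
    the position of that value, which moves the plotted point onto the axis.\<close>
  obtain s where s: "continuous_on UNIV s" "\<And>k. k \<in> {1..n} \<Longrightarrow> s (real k) = real (inv x k)"
    using ex_continuous_interpolation[of n "\<lambda>k. real (inv x k)"] by blast
  define I where "I = {i. 1 \<le> i \<and> i < n \<and> x (i + 1) < x i}"
  define y where "y i t = real (x (i + 1)) + t * (real (x i) - real (x (i + 1)))" for i t
  \<comment> \<open>The segment of a descent, traversed upward from
    \<open>(i + 1, x (i + 1))\<close> at \<open>t = 0\<close> to \<open>(i, x i)\<close> at
    \<open>t = 1\<close>, and then sheared.\<close>
  define c where "c i t = (real i + 1 - t - s (y i t), y i t)" for i t
  have inv: "inv x (x k) = k" "x (inv x k) = k" for k using permutes_inverses[OF x] by auto
  have xn: "x k \<in> {1..n} \<longleftrightarrow> k \<in> {1..n}" for k using permutes_in_image[OF x] .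
  have ends: "pathstart (c i) = pt (x (i + 1))" "pathfinish (c i) = pt (x i)" if "i \<in> I" for i
    using that s(2)[of "x (i + 1)"] s(2)[of "x i"] xn[of i] xn[of "i + 1"] inv
    by (auto simp: I_def pathstart_def pathfinish_def pt_def c_def y_def)
  have at: "(X, real k) \<in> path_image (c i) \<longleftrightarrow>
      (\<exists>t. 0 < t \<and> t < 1 \<and> y i t = real k \<and> X = real i + 1 - t - real (inv x k))"
    if i: "i \<in> I" and k: "x (i + 1) < k" "k < x i" for i k X
  proof -
    have "k \<in> {1..n}" using k i xn[of i] by (auto simp: I_def)
    moreover have "t \<noteq> 0 \<and> t \<noteq> 1" if "y i t = real k" for t using that k by (auto simp: y_def)
    moreover have "(X, real k) \<in> path_image (c i) \<longleftrightarrow> (\<exists>t\<in>{0..1}. c i t = (X, real k))"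
      unfolding path_image_def by (metis image_iff)
    ultimately show ?thesis
      using s(2)[of k] unfolding c_def by (smt (verit) Pair_inject atLeastAtMost_iff)
  qed
  have arc: "is_arc n (c i)" if i: "i \<in> I" for i
  proof -
    have "path (c i)"
      unfolding path_def c_def y_def
      by (intro continuous_intros continuous_on_compose2[OF s(1)]) auto
    moreover have "strict_mono_on {0..1} (\<lambda>t. snd (c i t))"
      using i by (auto simp: strict_mono_on_def c_def y_def I_def)
    moreover have "1 \<le> x (i + 1)" "x (i + 1) < x i" "x i \<le> n"
      using xn[of i] xn[of "i + 1"] i by (auto simp: I_def)
    moreover have "pt k \<notin> path_image (c i)" if k: "x (i + 1) < k" "k < x i" for k
    proof
      assume "pt k \<in> path_image (c i)"
      then obtain t where "0 < t" "t < 1" "0 = real i + 1 - t - real (inv x k)"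
        using at[OF i k, of 0] by (auto simp: pt_def)
      \<comment> \<open>Meeting the point would put the position of \<open>k\<close> strictly
        between two consecutive integers.\<close>
      then have "real i < real (inv x k)" "real (inv x k) < real (i + 1)" by auto
      then show False by simp
    qed
    ultimately show ?thesis using ends[OF i] by (intro is_arcI[of "c i" "x (i + 1)" "x i"])
  qed
  have left: "passed_on_left n (c i) = {k. x (i + 1) < k \<and> k < x i \<and> i + 1 < inv x k}" if i: "i \<in> I" for i
  proof -
    have "k \<in> passed_on_left n (c i) \<longleftrightarrow> i + 1 < inv x k" if k: "x (i + 1) < k" "k < x i" for k
    proof
      assume "k \<in> passed_on_left n (c i)"
      then obtain X t where "X < 0" "0 < t" "t < 1" "X = real i + 1 - t - real (inv x k)"
        using at[OF i k] by (auto simp: passed_on_left_def)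
      then have "real i < real (inv x k)" by linarith
      then have "i + 1 \<le> inv x k" by simp
      \<comment> \<open>Position \<open>i + 1\<close> is occupied by the smaller value
        \<open>x (i + 1)\<close>.\<close>
      moreover have "inv x k \<noteq> i + 1" using k(1) inv(2)[of k] by auto
      ultimately show "i + 1 < inv x k" by simp
    next
      assume *: "i + 1 < inv x k"
      \<comment> \<open>The parameter at which the segment reaches height \<open>k\<close>.\<close>
      define t where "t = (real k - real (x (i + 1))) / (real (x i) - real (x (i + 1)))"
      have "0 < t" "t < 1" "y i t = real k" using k by (auto simp: t_def y_def field_simps)
      then have "(real i + 1 - t - real (inv x k), real k) \<in> path_image (c i)"
        using at[OF i k] by blast
      moreover have "real i + 1 - t - real (inv x k) < 0" using * \<open>0 < t\<close> by linarith
      moreover have "k \<in> {1..n}" using k i xn[of i] by (auto simp: I_def)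
      ultimately show "k \<in> passed_on_left n (c i)" unfolding passed_on_left_def by blast
    qed
    then show ?thesis using passed_on_left_between[OF arc[OF i] ends[OF i]] by auto
  qed
  have disj: "path_image (c i) \<inter> path_image (c j) = {}" if ij: "i \<in> I" "j \<in> I" "i < j" for i j
  proof (rule ccontr)
    assume "path_image (c i) \<inter> path_image (c j) \<noteq> {}"
    then obtain z where "z \<in> c i ` {0..1}" "z \<in> c j ` {0..1}"
      unfolding path_image_def by blast
    then obtain t u where "t \<in> {0..1}" "u \<in> {0..1}" "z = c i t" "z = c j u"
      by (elim imageE)
    then have tu: "t \<in> {0..1}" "u \<in> {0..1}" "c i t = c j u" by auto
    \<comment> \<open>At equal heights the shears agree, so the abscissas agree before shearing as
      well. These lie in \<open>[i, i + 1]\<close> and \<open>[j, j + 1]\<close>, which leaves only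
      \<open>j = i + 1\<close>, two consecutive descents.\<close>
    then have "real i - t = real j - u" by (auto simp: c_def)
    then have "j = i + 1" using tu ij(3) by auto
    then show False using av ij unfolding avoids_consecutive_321_def I_def
      by (auto simp: numeral_2_eq_2)
  qed
  have "is_matching (c ` I)"
    unfolding is_matching_def
  proof (rule pairwiseI)
    fix a b assume "a \<in> c ` I" "b \<in> c ` I" "a \<noteq> b"
    then obtain i j where "i \<in> I" "j \<in> I" "a = c i" "b = c j" "i \<noteq> j" by auto
    then show "path_image a \<inter> path_image b = {}"
      using disj[of i j] disj[of j i] by (cases i j rule: linorder_cases) auto
  qed
  moreover from this have "noncrossing_arc_diagram n (c ` I)"
    using arc by (intro disjoint_arcs_diagram) auto
  moreover have "arc_data n (c ` I) = descent_data n x"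
  proof (intro equalityI subsetI)
    fix z assume "z \<in> arc_data n (c ` I)"
    then obtain i p q L where "z = (p, q, L)" "i \<in> I" "pathstart (c i) = pt p" "pathfinish (c i) = pt q"
      "passed_on_left n (c i) = L" unfolding arc_data_def by blast
    then show "z \<in> descent_data n x"
      using ends[of i] left[of i] unfolding descent_data_def by (auto simp: I_def)
  next
    fix z assume "z \<in> descent_data n x"
    then obtain i where "i \<in> I" "z = (x (i + 1), x i, {k. x (i + 1) < k \<and> k < x i \<and> i + 1 < inv x k})"
      unfolding descent_data_def I_def by blast
    then show "z \<in> arc_data n (c ` I)"
      using ends[of i] left[of i] unfolding arc_data_def by auto
  qed
  ultimately show ?thesis by blast
qed

section \<open>Equivalence classes and the bijection\<close>

text \<open>Arcs of a diagram have distinct lower endpoints, so no triple arises from two arcs, and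
  equal sets of triples match the arcs one to one.\<close>

lemma diagram_equiv_iff_arc_data:
  assumes D: "noncrossing_arc_diagram n D" and E: "noncrossing_arc_diagram n E"
  shows "(D, E) \<in> diagram_equiv n \<longleftrightarrow> arc_data n D = arc_data n E"
proof
  assume "(D, E) \<in> diagram_equiv n"
  then obtain f where f: "bij_betw f D E" "\<forall>c\<in>D. arc_equiv n c (f c)"
    by (auto simp: diagram_equiv_def)
  have "E = f ` D" using f(1) by (simp add: bij_betw_def)
  moreover have "pathstart (f c) = pathstart c" "pathfinish (f c) = pathfinish c"
    "passed_on_left n (f c) = passed_on_left n c" if "c \<in> D" for c
    using f(2) that by (auto simp: arc_equiv_def)
  ultimately show "arc_data n D = arc_data n E"
    by (simp add: arc_data_def cong: bex_cong)
next
  assume eq: "arc_data n D = arc_data n E"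
  \<comment> \<open>Stated for arbitrary \<open>D'\<close> and \<open>E'\<close> because it serves
    in both directions: from \<open>D\<close> to \<open>E\<close> it yields \<open>f\<close>, from
    \<open>E\<close> to \<open>D\<close> the surjectivity of \<open>f\<close>.\<close>
  have match: "\<exists>e\<in>E'. arc_equiv n c e"
    if D': "noncrossing_arc_diagram n D'" and data: "arc_data n D' = arc_data n E'" and c: "c \<in> D'"
    for c D' E'
  proof -
    obtain p q where "pathstart c = pt p" "pathfinish c = pt q"
      using D' c unfolding noncrossing_arc_diagram_def by (meson is_arcE)
    then have "(p, q, passed_on_left n c) \<in> arc_data n D'" using c by (auto simp: arc_data_def)
    then have "(p, q, passed_on_left n c) \<in> arc_data n E'" using data by simp
    then obtain e where "e \<in> E'" "pathstart e = pt p" "pathfinish e = pt q"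
      "passed_on_left n e = passed_on_left n c" by (auto simp: arc_data_def)
    then show ?thesis
      using \<open>pathstart c = pt p\<close> \<open>pathfinish c = pt q\<close>
      unfolding arc_equiv_def by (intro bexI[of _ e]) simp_all
  qed
  have inj: "c = d" if "noncrossing_arc_diagram n D'" "c \<in> D'" "d \<in> D'" "pathstart c = pathstart d" for c d D'
    using that by (auto simp: noncrossing_arc_diagram_def pairwise_def)
  obtain f where f: "\<And>c. c \<in> D \<Longrightarrow> f c \<in> E \<and> arc_equiv n c (f c)"
    using match[OF D eq] by metis
  have "inj_on f D"
    using f inj[OF D] by (intro inj_onI) (metis arc_equiv_def)
  moreover have "e \<in> f ` D" if e: "e \<in> E" for e
  proof -
    obtain c where "c \<in> D" "arc_equiv n e c" using match[OF E eq[symmetric] e] by blast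
    then have "f c = e" using f[of c] inj[OF E _ e] by (auto simp: arc_equiv_def)
    then show ?thesis using \<open>c \<in> D\<close> by blast
  qed
  ultimately have "bij_betw f D E" using f by (auto simp: bij_betw_def)
  then show "(D, E) \<in> diagram_equiv n" using D E f by (auto simp: diagram_equiv_def)
qed

theorem theorem3p8:
  fixes n :: nat
  assumes "n \<ge> 1"
  shows "\<exists>f. bij_betw f
           ({D. noncrossing_arc_diagram n D \<and> is_matching D} // diagram_equiv n)
           {x. x permutes {1..n} \<and> avoids_consecutive_321 n x}"
proof -
  let ?M = "{D. noncrossing_arc_diagram n D \<and> is_matching D}"
  let ?P = "{x. x permutes {1..n} \<and> avoids_consecutive_321 n x}"
  note equiv = equiv_diagram_equiv[of n]
  obtain d where d: "\<And>x. x \<in> ?P \<Longrightarrow>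
      noncrossing_arc_diagram n (d x) \<and> is_matching (d x) \<and> arc_data n (d x) = descent_data n x"
    using ex_diagram_descent_data[of _ n] by (metis (mono_tags, lifting) mem_Collect_eq)
  \<comment> \<open>The map is built from permutations to classes, where a chosen drawing
    \<open>d x\<close> defines it, and is inverted at the end.\<close>
  have "bij_betw (\<lambda>x. diagram_equiv n `` {d x}) ?P (?M // diagram_equiv n)"
  proof (intro bij_betw_imageI inj_onI equalityI subsetI)
    fix x y assume x: "x \<in> ?P" and y: "y \<in> ?P" and "diagram_equiv n `` {d x} = diagram_equiv n `` {d y}"
    then have "(d x, d y) \<in> diagram_equiv n"
      using eq_equiv_class[OF _ equiv] d[OF y] by simp
    then have "descent_data n x = descent_data n y"
      using diagram_equiv_iff_arc_data[of n "d x" "d y"] d[OF x] d[OF y] by simp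
    then show "x = y" using inj_onD[OF inj_on_descent_data] x y by simp
  next
    fix X assume "X \<in> (\<lambda>x. diagram_equiv n `` {d x}) ` ?P"
    then obtain x where "x \<in> ?P" "X = diagram_equiv n `` {d x}" by blast
    then show "X \<in> ?M // diagram_equiv n" using d[of x] by (simp add: quotientI)
  next
    fix X assume "X \<in> ?M // diagram_equiv n"
    then obtain D where D: "noncrossing_arc_diagram n D" "is_matching D" "X = diagram_equiv n `` {D}"
      by (auto elim: quotientE)
    \<comment> \<open>Surjectivity: the ranking of \<open>D\<close> produces a permutation whose
      descents are the arcs of \<open>D\<close>, and its chosen drawing then has the same arc data
      as \<open>D\<close>.\<close>
    obtain F where "ranks n (arc_data n D) F" using ex_ranks_arc_data D by blast
    then obtain x where x: "x \<in> ?P" "descent_data n x = arc_data n D"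
      using ex_permutation_descent_data[of n "arc_data n D" F] matching_arc_data_disjoint[OF D(2)] by blast
    then have "(d x, D) \<in> diagram_equiv n"
      using diagram_equiv_iff_arc_data[of n "d x" D] d[OF x(1)] D(1) by simp
    then have "X = diagram_equiv n `` {d x}" using equiv_class_eq[OF equiv] D(3) by simp
    then show "X \<in> (\<lambda>x. diagram_equiv n `` {d x}) ` ?P" using x(1) by blast
  qed
  then show ?thesis using bij_betw_inv by blast
qed

end
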